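(* Let $R$ be a ring and let $I$ be an exchange ideal of $R$. Then the following are equivalent: (1) $I$ is square stable. (2) For any $a\in I$, $a^2\in J(R)$ implies $a\in J(R)$.
   Context: All rings are associative with identity and all ideals are two-sided. $J(R)$ denotes the Jacobson radical of $R$. An ideal $I$ of a ring $R$ is square stable if whenever $aR+bR=R$ with $a\in I$ and $b\in R$, there exists $y\in R$ such that $a^2+by$ is a unit of $R$. An ideal $I$ of $R$ is an exchange ideal if for any $a\in I$ there exist an idempotent $e\in I$ and $x,y\in I$ such that $e=ax=a+y-ay$; equivalently (a known fact), for any $a\in I$ there exists an idempotent $e\in R$ such that $e\in aR$ and $1-e\in(1-a)R$. *)

theory Defs
  imports "HOL-Algebra.Ideal"
begin

definition right_ideal :: "'a set \<Rightarrow> ('a, 'm) ring_scheme \<Rightarrow> bool" where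
  "right_ideal K R \<longleftrightarrow>
     additive_subgroup K R \<and> (\<forall>k\<in>K. \<forall>r\<in>carrier R. k \<otimes>\<^bsub>R\<^esub> r \<in> K)"

definition maximal_right_ideal :: "'a set \<Rightarrow> ('a, 'm) ring_scheme \<Rightarrow> bool" where
  "maximal_right_ideal M R \<longleftrightarrow>
     right_ideal M R \<and> M \<noteq> carrier R \<and>
     (\<forall>K. right_ideal K R \<longrightarrow> M \<subseteq> K \<longrightarrow> K = M \<or> K = carrier R)"

(* The intersection is taken inside the carrier, so the radical of the zero ring,
   which has no maximal right ideals, is the whole ring. *)
definition jacobson_radical :: "('a, 'm) ring_scheme \<Rightarrow> 'a set" where
  "jacobson_radical R = {a \<in> carrier R. \<forall>M. maximal_right_ideal M R \<longrightarrow> a \<in> M}"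

(* For a ring element a, the library's l_coset a <# carrier R is the principal right ideal aR,
   and <+> is the sum of subsets. *)
definition square_stable :: "'a set \<Rightarrow> ('a, 'm) ring_scheme \<Rightarrow> bool" where
  "square_stable I R \<longleftrightarrow>
     (\<forall>a\<in>I. \<forall>b\<in>carrier R.
        (a <#\<^bsub>R\<^esub> carrier R) <+>\<^bsub>R\<^esub> (b <#\<^bsub>R\<^esub> carrier R) = carrier R \<longrightarrow>
        (\<exists>y\<in>carrier R. a [^]\<^bsub>R\<^esub> (2::nat) \<oplus>\<^bsub>R\<^esub> b \<otimes>\<^bsub>R\<^esub> y \<in> Units R))"

definition exchange_ideal :: "'a set \<Rightarrow> ('a, 'm) ring_scheme \<Rightarrow> bool" where
  "exchange_ideal I R \<longleftrightarrow>
     ideal I R \<and>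
     (\<forall>a\<in>I. \<exists>e\<in>I. \<exists>x\<in>I. \<exists>y\<in>I.
        e \<otimes>\<^bsub>R\<^esub> e = e \<and> e = a \<otimes>\<^bsub>R\<^esub> x \<and> e = a \<oplus>\<^bsub>R\<^esub> y \<ominus>\<^bsub>R\<^esub> a \<otimes>\<^bsub>R\<^esub> y)"

end

theory Submission
  imports Defs "HOL-Algebra.QuotRing"
begin

text \<open>
  Throughout, J is the Jacobson radical of R, in the form that is easy to compute with: a belongs
  to J iff every \<open>1 - a r\<close> has a right inverse. It follows that J is a two-sided ideal and that an
  element is a unit of R as soon as its class is a unit of R/J.

  Square stability forces \<open>a \<in> J\<close> when \<open>a\<^sup>2 \<in> J\<close>: the pair \<open>a\<close>, \<open>b = 1 - a r\<close> always generates R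
  as a right ideal, and if \<open>a\<^sup>2 + b y\<close> is a unit then so is \<open>b y\<close>, since the two differ by a radical
  element; thus b has a right inverse.

  For the converse, the condition on squares says that the image of I in R/J has no nonzero element
  of square zero, so all idempotents in that image are central. Given \<open>a R + b R = R\<close> with
  \<open>a \<in> I\<close>, write \<open>1 = a x + b y\<close>; the exchange property at \<open>a x\<close> yields an idempotent \<open>e = a s\<close> in I
  with \<open>1 - e = b t\<close>. Choosing \<open>t (1 - a\<^sup>2)\<close> as the multiplier of b gives
  \<open>a\<^sup>2 + (1 - e) (1 - a\<^sup>2) = e a\<^sup>2 + (1 - e)\<close>.
  Modulo J the idempotent e is central, so the ring splits into two corners; the element is 1 on the
  corner of \<open>1 - e\<close>, and on the corner of e it is the square of a, which there has the right inverse
  s. In a reduced corner one-sided inverses are two-sided, so the element is a unit modulo J, hence a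
  unit.
\<close>

section \<open>The Jacobson radical\<close>

text \<open>
  Closure under negation comes for free, as \<open>- x = x (- 1)\<close>.
\<close>

lemma (in ring) right_idealI:
  assumes "K \<subseteq> carrier R" "\<zero> \<in> K" "\<And>x y. x \<in> K \<Longrightarrow> y \<in> K \<Longrightarrow> x \<oplus> y \<in> K"
    and mult: "\<And>x r. x \<in> K \<Longrightarrow> r \<in> carrier R \<Longrightarrow> x \<otimes> r \<in> K"
  shows "right_ideal K R"
proof -
  have "\<ominus> x \<in> K" if "x \<in> K" for x
  proof -
    have "x \<in> carrier R" using assms(1) that by blast
    then show ?thesis using mult[OF that, of "\<ominus> \<one>"] by (simp add: r_minus)
  qed
  then have "subgroup K (add_monoid R)"
    using assms(1-3) by (intro add.subgroupI) (auto simp: a_inv_def)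
  then show ?thesis
    using mult by (auto simp: right_ideal_def intro: additive_subgroupI)
qed

lemma right_ideal_subset: "right_ideal K R \<Longrightarrow> K \<subseteq> carrier R"
  by (simp add: right_ideal_def additive_subgroup.a_subset)

lemma right_ideal_zero: "right_ideal K R \<Longrightarrow> \<zero>\<^bsub>R\<^esub> \<in> K"
  by (simp add: right_ideal_def additive_subgroup.zero_closed)

lemma right_ideal_add: "right_ideal K R \<Longrightarrow> x \<in> K \<Longrightarrow> y \<in> K \<Longrightarrow> x \<oplus>\<^bsub>R\<^esub> y \<in> K"
  by (simp add: right_ideal_def additive_subgroup.a_closed)

lemma right_ideal_mult: "right_ideal K R \<Longrightarrow> x \<in> K \<Longrightarrow> r \<in> carrier R \<Longrightarrow> x \<otimes>\<^bsub>R\<^esub> r \<in> K"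
  by (simp add: right_ideal_def)

lemma (in ring) right_ideal_Union_chain:
  assumes "C \<noteq> {}" "subset.chain {K. right_ideal K R} C"
  shows "right_ideal (\<Union>C) R"
proof (rule right_idealI)
  have K: "right_ideal K R" if "K \<in> C" for K
    using assms(2) that by (auto simp: subset_chain_def)
  show "\<Union>C \<subseteq> carrier R" "\<zero> \<in> \<Union>C"
    using K right_ideal_subset right_ideal_zero assms(1) by blast+
  show "x \<otimes> r \<in> \<Union>C" if "x \<in> \<Union>C" "r \<in> carrier R" for x r
    using that by (auto intro: right_ideal_mult[OF K])
  fix x y assume "x \<in> \<Union>C" "y \<in> \<Union>C"
  then obtain K L where KL: "K \<in> C" "x \<in> K" "L \<in> C" "y \<in> L" by blast
  then have "K \<subseteq> L \<or> L \<subseteq> K"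
    using assms(2) by (auto simp: subset_chain_def)
  then obtain N where "N \<in> C" "x \<in> N" "y \<in> N"
    using KL by blast
  then show "x \<oplus> y \<in> \<Union>C"
    by (intro UnionI[of N] right_ideal_add[OF K])
qed

lemma (in ring) right_ideal_principal:
  assumes "b \<in> carrier R"
  shows "right_ideal (b <# carrier R) R"
proof (rule right_idealI)
  show "b <# carrier R \<subseteq> carrier R"
    using assms by (auto simp: l_coset_def)
  have "\<zero> = b \<otimes> \<zero>" using assms by simp
  then show "\<zero> \<in> b <# carrier R"
    unfolding l_coset_def by blast
next
  fix x y assume "x \<in> b <# carrier R" "y \<in> b <# carrier R"
  then obtain r s where "r \<in> carrier R" "x = b \<otimes> r" "s \<in> carrier R" "y = b \<otimes> s"
    by (auto simp: l_coset_def)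
  then show "x \<oplus> y \<in> b <# carrier R"
    using assms by (auto simp: l_coset_def r_distr intro!: bexI[of _ "r \<oplus> s"])
next
  fix x r assume "x \<in> b <# carrier R" "r \<in> carrier R"
  then show "x \<otimes> r \<in> b <# carrier R"
    using assms by (auto simp: l_coset_def m_assoc)
qed

lemma (in ring) right_ideal_eq_carrier:
  assumes "right_ideal K R" "\<one> \<in> K"
  shows "K = carrier R"
proof
  show "K \<subseteq> carrier R" using assms(1) by (rule right_ideal_subset)
  show "carrier R \<subseteq> K"
    using right_ideal_mult[OF assms] by auto
qed

text \<open>
  Zorn's lemma applies because a right ideal is proper exactly when it omits 1, a condition that
  survives unions of chains.
\<close>

lemma (in ring) right_ideal_subset_maximal:
  assumes "right_ideal K R" "\<one> \<notin> K"
  obtains M where "maximal_right_ideal M R" "K \<subseteq> M"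
proof -
  let ?A = "{L. right_ideal L R \<and> \<one> \<notin> L \<and> K \<subseteq> L}"
  have "\<exists>M\<in>?A. \<forall>X\<in>?A. M \<subseteq> X \<longrightarrow> X = M"
  proof (rule subset_Zorn_nonempty)
    show "?A \<noteq> {}" using assms by blast
    fix C assume C: "C \<noteq> {}" "subset.chain ?A C"
    then have "subset.chain {L. right_ideal L R} C"
      by (auto simp: subset_chain_def)
    then show "\<Union>C \<in> ?A"
      using right_ideal_Union_chain[OF C(1)] C by (auto simp: subset_chain_def)
  qed
  then obtain M where M: "M \<in> ?A" and max: "\<forall>X\<in>?A. M \<subseteq> X \<longrightarrow> X = M"
    by (rule bexE)
  have "L = M \<or> L = carrier R" if "right_ideal L R" "M \<subseteq> L" for L
  proof (cases "\<one> \<in> L")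
    case False
    then have "L \<in> ?A" using M that by auto
    then show ?thesis using max that(2) by simp
  qed (simp add: right_ideal_eq_carrier that(1))
  then have "maximal_right_ideal M R"
    using M by (auto simp: maximal_right_ideal_def)
  then show ?thesis using that M by simp
qed

lemma (in ring) right_ideal_sum:
  assumes K: "right_ideal K R" and L: "right_ideal L R"
  shows "right_ideal (K <+>\<^bsub>R\<^esub> L) R"
proof -
  have "additive_subgroup (K <+>\<^bsub>R\<^esub> L) R"
    using K L by (intro add_additive_subgroups) (simp_all add: right_ideal_def)
  moreover have "x \<otimes> r \<in> K <+>\<^bsub>R\<^esub> L" if x: "x \<in> K <+>\<^bsub>R\<^esub> L" and r: "r \<in> carrier R" for x r
  proof -
    obtain k l where kl: "k \<in> K" "l \<in> L" "x = k \<oplus> l"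
      using x unfolding set_add_def' by blast
    then have "k \<in> carrier R" "l \<in> carrier R"
      using right_ideal_subset[OF K] right_ideal_subset[OF L] by auto
    then have "x \<otimes> r = k \<otimes> r \<oplus> l \<otimes> r"
      using kl r by (simp add: l_distr)
    then show ?thesis
      using right_ideal_mult[OF K kl(1) r] right_ideal_mult[OF L kl(2) r]
      unfolding set_add_def' by blast
  qed
  ultimately show ?thesis by (simp add: right_ideal_def)
qed

text \<open>
  Both directions play a maximal right ideal M off against \<open>1 - a r\<close>. If \<open>1 - a r\<close> has no right
  inverse, some M contains it; M cannot contain a as well, for then it would contain 1. Conversely,
  if M omits a, then \<open>M + a R = R\<close>, so some \<open>1 - a r\<close> lies in M and has no right inverse.
\<close>

lemma (in ring) jacobson_radical_iff:
  "a \<in> jacobson_radical R \<longleftrightarrow>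
     a \<in> carrier R \<and> (\<forall>r\<in>carrier R. \<exists>u\<in>carrier R. (\<one> \<ominus> a \<otimes> r) \<otimes> u = \<one>)"
proof (intro iffI conjI ballI)
  assume a: "a \<in> jacobson_radical R"
  then show ac: "a \<in> carrier R" by (simp add: jacobson_radical_def)
  fix r assume r: "r \<in> carrier R"
  let ?b = "\<one> \<ominus> a \<otimes> r"
  have b: "?b \<in> carrier R" using ac r by simp
  show "\<exists>u\<in>carrier R. ?b \<otimes> u = \<one>"
  proof (rule ccontr)
    assume "\<not> ?thesis"
    then have "\<one> \<notin> ?b <# carrier R" by (auto simp: l_coset_def)
    then obtain M where M: "maximal_right_ideal M R" "?b <# carrier R \<subseteq> M"
      using right_ideal_subset_maximal right_ideal_principal[OF b] by blast
    have rM: "right_ideal M R" and ne: "M \<noteq> carrier R"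
      using M by (auto simp: maximal_right_ideal_def)
    have "?b \<in> ?b <# carrier R"
      using b by (auto simp: l_coset_def intro!: bexI[of _ \<one>])
    then have "?b \<in> M" using M by blast
    moreover have "a \<otimes> r \<in> M"
      using a M r right_ideal_mult[OF rM] by (simp add: jacobson_radical_def)
    ultimately have "?b \<oplus> a \<otimes> r \<in> M"
      by (rule right_ideal_add[OF rM])
    moreover have "?b \<oplus> a \<otimes> r = \<one>" using ac r by algebra
    ultimately show False using right_ideal_eq_carrier rM ne by simp
  qed
next
  assume *: "a \<in> carrier R \<and> (\<forall>r\<in>carrier R. \<exists>u\<in>carrier R. (\<one> \<ominus> a \<otimes> r) \<otimes> u = \<one>)"
  then have ac: "a \<in> carrier R" by blast
  have "a \<in> M" if M: "maximal_right_ideal M R" for M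
  proof (rule ccontr)
    assume aM: "a \<notin> M"
    have rM: "right_ideal M R" and ne: "M \<noteq> carrier R"
      using M by (auto simp: maximal_right_ideal_def)
    have Mc: "m \<in> carrier R" if "m \<in> M" for m
      using right_ideal_subset[OF rM] that by blast
    let ?K = "M <+>\<^bsub>R\<^esub> (a <# carrier R)"
    have "a = \<zero> \<oplus> a \<otimes> \<one>" using ac by simp
    then have "a \<in> ?K"
      using right_ideal_zero[OF rM] unfolding set_add_def' l_coset_def by blast
    moreover have "M \<subseteq> ?K"
    proof
      fix m assume m: "m \<in> M"
      then have "m = m \<oplus> a \<otimes> \<zero>" using ac Mc by simp
      with m show "m \<in> ?K" unfolding set_add_def' l_coset_def by blast
    qed
    ultimately have "?K = carrier R"
      using M aM right_ideal_sum[OF rM right_ideal_principal[OF ac]]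
      unfolding maximal_right_ideal_def by blast
    then have "\<one> \<in> ?K" by simp
    then obtain m r where mr: "m \<in> M" "r \<in> carrier R" "\<one> = m \<oplus> a \<otimes> r"
      by (auto simp: set_add_def' l_coset_def)
    then have "m = \<one> \<ominus> a \<otimes> r"
      using ac Mc[of m] by (simp add: minus_eq a_assoc r_neg)
    then obtain u where "u \<in> carrier R" "m \<otimes> u = \<one>" using * mr by blast
    then have "\<one> \<in> M" using right_ideal_mult[OF rM mr(1)] by force
    then show False using right_ideal_eq_carrier rM ne by simp
  qed
  then show "a \<in> jacobson_radical R" using ac by (simp add: jacobson_radical_def)
qed

lemma (in ring) right_ideal_jacobson_radical: "right_ideal (jacobson_radical R) R"
proof -
  have "right_ideal M R" if "maximal_right_ideal M R" for M
    using that by (simp add: maximal_right_ideal_def)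
  then show ?thesis
    by (intro right_idealI)
      (auto simp: jacobson_radical_def right_ideal_zero right_ideal_add right_ideal_mult)
qed

text \<open>
  Left absorption is invisible in the definition by right ideals. It rests on the fact that
  \<open>1 - p q\<close> is right invertible whenever \<open>1 - q p\<close> is.
\<close>

lemma (in ring) ideal_jacobson_radical: "ideal (jacobson_radical R) R"
proof (rule idealI)
  show "ring R" by (rule ring_axioms)
  show "subgroup (jacobson_radical R) (add_monoid R)"
    using right_ideal_jacobson_radical
    by (simp add: right_ideal_def additive_subgroup.a_subgroup)
  fix a r assume a: "a \<in> jacobson_radical R" and r: "r \<in> carrier R"
  show "a \<otimes> r \<in> jacobson_radical R"
    using right_ideal_jacobson_radical a r by (simp add: right_ideal_def)
  have ac: "a \<in> carrier R" using a by (simp add: jacobson_radical_def)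
  have "\<exists>u\<in>carrier R. (\<one> \<ominus> r \<otimes> a \<otimes> x) \<otimes> u = \<one>" if x: "x \<in> carrier R" for x
  proof -
    obtain w where w: "w \<in> carrier R" "(\<one> \<ominus> a \<otimes> (x \<otimes> r)) \<otimes> w = \<one>"
      using a x r unfolding jacobson_radical_iff by (meson m_closed)
    \<comment> \<open>The witness is what the geometric series for the inverse of \<open>1 - r (a x)\<close> suggests.\<close>
    have "(\<one> \<ominus> r \<otimes> a \<otimes> x) \<otimes> (\<one> \<oplus> r \<otimes> w \<otimes> (a \<otimes> x))
        = \<one> \<ominus> r \<otimes> a \<otimes> x \<oplus> r \<otimes> ((\<one> \<ominus> a \<otimes> (x \<otimes> r)) \<otimes> w) \<otimes> (a \<otimes> x)"
      using ac r x w(1) by (simp add: ring_simprules)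
    also have "\<dots> = \<one>"
      unfolding w(2) using ac r x by algebra
    finally show ?thesis using ac r x w(1) by blast
  qed
  then show "r \<otimes> a \<in> jacobson_radical R"
    using ac r by (auto simp: jacobson_radical_iff)
qed

lemma (in monoid) Units_if_one_sided_inverses:
  assumes "z \<in> carrier G" "v \<in> carrier G" "w \<in> carrier G" "v \<otimes> z = \<one>" "z \<otimes> w = \<one>"
  shows "z \<in> Units G"
  using assms inv_unique[of v z w] by (auto simp: Units_def)

text \<open>
  A right inverse u of \<open>1 - a\<close> equals \<open>1 - a (- u)\<close>, so it has a right inverse too; having inverses
  on both sides, u is a unit.
\<close>

lemma (in ring) one_minus_jacobson_radical_Units:
  assumes "a \<in> jacobson_radical R"
  shows "\<one> \<ominus> a \<in> Units R"
proof -
  have ac: "a \<in> carrier R" using assms by (simp add: jacobson_radical_def)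
  have right_inv: "\<exists>u\<in>carrier R. (\<one> \<ominus> a \<otimes> r) \<otimes> u = \<one>" if "r \<in> carrier R" for r
    using assms that jacobson_radical_iff by blast
  obtain u where u: "u \<in> carrier R" "(\<one> \<ominus> a) \<otimes> u = \<one>"
    using right_inv[of \<one>] ac by auto
  have "u = (\<one> \<ominus> a) \<otimes> u \<oplus> a \<otimes> u" using ac u(1) by algebra
  also have "\<dots> = \<one> \<ominus> a \<otimes> (\<ominus> u)"
    unfolding u(2) using ac u(1) by algebra
  finally obtain v where v: "v \<in> carrier R" "u \<otimes> v = \<one>"
    using right_inv[of "\<ominus> u"] u(1) by auto
  have "\<one> \<ominus> a = v"
    using inv_unique[of "\<one> \<ominus> a" u v] ac u v by simp
  then show ?thesis
    using u v by (auto simp: Units_def)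
qed

lemma (in ring) Units_minus_jacobson_radical:
  assumes "u \<in> Units R" "j \<in> jacobson_radical R"
  shows "u \<ominus> j \<in> Units R"
proof -
  have c: "u \<in> carrier R" "inv u \<in> carrier R" "j \<in> carrier R"
    using assms by (auto simp: jacobson_radical_def)
  have "j \<otimes> inv u \<in> jacobson_radical R"
    using right_ideal_jacobson_radical assms c by (simp add: right_ideal_def)
  then have "(\<one> \<ominus> j \<otimes> inv u) \<otimes> u \<in> Units R"
    using one_minus_jacobson_radical_Units assms by blast
  also have "(\<one> \<ominus> j \<otimes> inv u) \<otimes> u = u \<ominus> j \<otimes> (inv u \<otimes> u)"
    using c by algebra
  finally show ?thesis using assms c by simp
qed

lemma (in ring) one_minus_in_jacobson_radical_Units:
  assumes "x \<in> carrier R" "\<one> \<ominus> x \<in> jacobson_radical R"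
  shows "x \<in> Units R"
proof -
  have "\<one> \<ominus> (\<one> \<ominus> x) = x" using assms(1) by algebra
  then show ?thesis using one_minus_jacobson_radical_Units[OF assms(2)] by simp
qed

lemma (in ring) quotient_class_eq_zero_iff:
  assumes "ideal J R" "x \<in> carrier R"
  shows "J +> x = \<zero>\<^bsub>R Quot J\<^esub> \<longleftrightarrow> x \<in> J"
proof -
  interpret ideal J R by fact
  show ?thesis
    using assms(2) a_rcos_const a_rcos_self by (auto simp: FactRing_def)
qed

text \<open>
  An inverse modulo J lifts to some w for which \<open>w z\<close> and \<open>z w\<close> are congruent to 1, hence are units;
  so z has inverses on both sides.
\<close>

lemma (in ring) Units_lift_jacobson_radical:
  assumes z: "z \<in> carrier R"
    and unit: "jacobson_radical R +> z \<in> Units (R Quot jacobson_radical R)"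
  shows "z \<in> Units R"
proof -
  let ?J = "jacobson_radical R"
  interpret J: ideal ?J R by (rule ideal_jacobson_radical)
  interpret h: ring_hom_ring R "R Quot ?J" "(+>) ?J" by (rule J.rcos_ring_hom_ring)
  have Units_if: "x \<in> Units R" if "x \<in> carrier R" "?J +> x = \<one>\<^bsub>R Quot ?J\<^esub>" for x
  proof -
    have "?J +> (\<one> \<ominus> x) = \<zero>\<^bsub>R Quot ?J\<^esub>"
      using that by (simp add: minus_eq h.S.r_neg)
    then show ?thesis
      using quotient_class_eq_zero_iff[OF J.ideal_axioms] that one_minus_in_jacobson_radical_Units
      by simp
  qed
  obtain W where "W \<in> carrier (R Quot ?J)"
      "W \<otimes>\<^bsub>R Quot ?J\<^esub> (?J +> z) = \<one>\<^bsub>R Quot ?J\<^esub>" "(?J +> z) \<otimes>\<^bsub>R Quot ?J\<^esub> W = \<one>\<^bsub>R Quot ?J\<^esub>"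
    using unit by (auto simp: Units_def)
  then obtain w where w: "w \<in> carrier R"
      "(?J +> w) \<otimes>\<^bsub>R Quot ?J\<^esub> (?J +> z) = \<one>\<^bsub>R Quot ?J\<^esub>" "(?J +> z) \<otimes>\<^bsub>R Quot ?J\<^esub> (?J +> w) = \<one>\<^bsub>R Quot ?J\<^esub>"
    by (auto simp: FactRing_def A_RCOSETS_defs a_r_coset_def r_coset_def)
  have l: "w \<otimes> z \<in> Units R" and r: "z \<otimes> w \<in> Units R"
    using w z by (auto intro!: Units_if)
  show ?thesis
  proof (rule Units_if_one_sided_inverses)
    show "inv (w \<otimes> z) \<otimes> w \<otimes> z = \<one>" "z \<otimes> (w \<otimes> inv (z \<otimes> w)) = \<one>"
      using l r w z by (simp_all add: m_assoc) (simp_all flip: m_assoc)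
  qed (use l r w z in auto)
qed

section \<open>Reduced ideals\<close>

text \<open>
  Excluding square-zero elements excludes all nilpotent ones: the last nonzero power of a nilpotent
  element of K has square zero.
\<close>

definition reduced_ideal :: "'a set \<Rightarrow> ('a, 'm) ring_scheme \<Rightarrow> bool" where
  "reduced_ideal K R \<longleftrightarrow>
     ideal K R \<and> (\<forall>k\<in>K. k \<otimes>\<^bsub>R\<^esub> k = \<zero>\<^bsub>R\<^esub> \<longrightarrow> k = \<zero>\<^bsub>R\<^esub>)"

text \<open>
  The off-diagonal Peirce components \<open>e r (1 - e)\<close> and \<open>(1 - e) r e\<close> lie in K and have square zero.
\<close>

lemma (in ring) idempotent_central_if_reduced_ideal:
  assumes red: "reduced_ideal K R" and e: "e \<in> K" "e \<otimes> e = e" and r: "r \<in> carrier R"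
  shows "e \<otimes> r = r \<otimes> e"
proof -
  interpret ideal K R using red by (simp add: reduced_ideal_def)
  have c: "e \<in> carrier R" using e a_subset by blast
  have nil: "k = \<zero>" if "k \<in> K" "k \<otimes> k = \<zero>" for k
    using red that by (simp add: reduced_ideal_def)
  have ann: "(\<one> \<ominus> e) \<otimes> e = \<zero>" "e \<otimes> (\<one> \<ominus> e) = \<zero>"
    using c e(2) by (simp_all add: minus_eq l_distr r_distr l_minus r_minus r_neg)
  have "e \<otimes> r \<otimes> (\<one> \<ominus> e) = \<zero>"
  proof (rule nil)
    have "(e \<otimes> r \<otimes> (\<one> \<ominus> e)) \<otimes> (e \<otimes> r \<otimes> (\<one> \<ominus> e))
        = e \<otimes> r \<otimes> ((\<one> \<ominus> e) \<otimes> e) \<otimes> (r \<otimes> (\<one> \<ominus> e))"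
      using c r by (simp add: m_assoc)
    also have "\<dots> = \<zero>" unfolding ann using c r by simp
    finally show "(e \<otimes> r \<otimes> (\<one> \<ominus> e)) \<otimes> (e \<otimes> r \<otimes> (\<one> \<ominus> e)) = \<zero>" .
  qed (use e c r in \<open>simp add: I_r_closed\<close>)
  moreover have "(\<one> \<ominus> e) \<otimes> r \<otimes> e = \<zero>"
  proof (rule nil)
    have "((\<one> \<ominus> e) \<otimes> r \<otimes> e) \<otimes> ((\<one> \<ominus> e) \<otimes> r \<otimes> e)
        = (\<one> \<ominus> e) \<otimes> r \<otimes> (e \<otimes> (\<one> \<ominus> e)) \<otimes> (r \<otimes> e)"
      using c r by (simp add: m_assoc)
    also have "\<dots> = \<zero>" unfolding ann using c r by simp
    finally show "((\<one> \<ominus> e) \<otimes> r \<otimes> e) \<otimes> ((\<one> \<ominus> e) \<otimes> r \<otimes> e) = \<zero>" .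
  qed (use e c r in \<open>simp add: I_l_closed\<close>)
  moreover have "e \<otimes> r \<otimes> (\<one> \<ominus> e) = e \<otimes> r \<ominus> e \<otimes> r \<otimes> e"
      "(\<one> \<ominus> e) \<otimes> r \<otimes> e = r \<otimes> e \<ominus> e \<otimes> r \<otimes> e"
    using c r by (simp_all add: minus_eq l_distr r_distr l_minus r_minus)
  moreover
  have "x = y" if "x \<ominus> y = \<zero>" "x \<in> carrier R" "y \<in> carrier R" for x y
  proof -
    have "x = (x \<ominus> y) \<oplus> y"
      using that(2,3) by (simp add: minus_eq a_assoc l_neg)
    with that show ?thesis by simp
  qed
  from this[of "e \<otimes> r" "e \<otimes> r \<otimes> e"] this[of "r \<otimes> e" "e \<otimes> r \<otimes> e"]
  have "e \<otimes> r = e \<otimes> r \<otimes> e" "r \<otimes> e = e \<otimes> r \<otimes> e"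
    using calculation c r by simp_all
  then show ?thesis by simp
qed

text \<open>
  The conclusion says that s is also a left inverse of a on the corner of the idempotent
  \<open>e = a s\<close>. The element \<open>f = e (s a) = s e a\<close> is again an idempotent of K, hence central, and moving
  it past a turns \<open>e = a f s\<close> into \<open>f e = f\<close>.
\<close>

lemma (in ring) right_inverse_in_reduced_corner:
  assumes red: "reduced_ideal K R" and as: "a \<in> carrier R" "s \<in> carrier R"
    and e: "a \<otimes> s \<in> K" "(a \<otimes> s) \<otimes> (a \<otimes> s) = a \<otimes> s"
  shows "(a \<otimes> s) \<otimes> (s \<otimes> a) = a \<otimes> s"
proof -
  interpret ideal K R using red by (simp add: reduced_ideal_def)
  let ?e = "a \<otimes> s"
  have c: "?e \<in> carrier R" using as by simp
  have e_central: "?e \<otimes> r = r \<otimes> ?e" if "r \<in> carrier R" for r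
    using idempotent_central_if_reduced_ideal[OF red e that] .
  define f where "f = s \<otimes> ?e \<otimes> a"
  have fc: "f \<in> carrier R" using as by (simp add: f_def)
  have fK: "f \<in> K" using as e by (simp add: f_def I_l_closed I_r_closed)
  have f_eq: "f = ?e \<otimes> (s \<otimes> a)"
    unfolding f_def e_central[OF as(2), symmetric] by (rule m_assoc[OF c as(2,1)])
  have "f \<otimes> f = s \<otimes> (?e \<otimes> ?e \<otimes> ?e) \<otimes> a"
    unfolding f_def using as by (simp add: m_assoc)
  also have "\<dots> = f"
    unfolding e(2) f_def ..
  finally have f_idem: "f \<otimes> f = f" .
  have "?e = ?e \<otimes> ?e \<otimes> ?e" by (simp only: e(2))
  also have "\<dots> = a \<otimes> f \<otimes> s"
    unfolding f_def using as by (simp add: m_assoc)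
  also have "\<dots> = f \<otimes> ?e"
    using idempotent_central_if_reduced_ideal[OF red fK f_idem as(1)] m_assoc[OF fc as] by simp
  also have "\<dots> = ?e \<otimes> f"
    by (rule e_central[OF fc, symmetric])
  also have "\<dots> = f"
    unfolding f_eq
    using m_assoc[OF c c, of "s \<otimes> a"] as e(2) by simp
  finally show ?thesis using f_eq by simp
qed

text \<open>
  The product decomposition of the ring along a central idempotent, in the special case of elements
  that are 1 in the second factor.
\<close>

lemma (in ring) central_idempotent_glue_inverse:
  assumes c: "e \<in> carrier R" "u \<in> carrier R" "v \<in> carrier R"
    and idem: "e \<otimes> e = e" and central: "e \<otimes> u = u \<otimes> e" and inv: "e \<otimes> (u \<otimes> v) = e"
  shows "(e \<otimes> u \<oplus> (\<one> \<ominus> e)) \<otimes> (e \<otimes> v \<oplus> (\<one> \<ominus> e)) = \<one>"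
proof -
  have ann: "(\<one> \<ominus> e) \<otimes> e = \<zero>" "e \<otimes> (\<one> \<ominus> e) = \<zero>"
    using c idem by (simp_all add: minus_eq l_distr r_distr l_minus r_minus r_neg)
  have ee: "(\<one> \<ominus> e) \<otimes> (\<one> \<ominus> e) = \<one> \<ominus> e"
  proof -
    have "(\<one> \<ominus> e) \<otimes> (\<one> \<ominus> e) = (\<one> \<ominus> e) \<ominus> (\<one> \<ominus> e) \<otimes> e"
      using c by (simp add: ring_simprules)
    then show ?thesis using ann c by (simp add: minus_eq)
  qed
  have "(e \<otimes> u \<oplus> (\<one> \<ominus> e)) \<otimes> (e \<otimes> v \<oplus> (\<one> \<ominus> e))
      = (e \<otimes> u) \<otimes> (e \<otimes> v) \<oplus> (u \<otimes> e) \<otimes> (\<one> \<ominus> e) \<oplus> (\<one> \<ominus> e) \<otimes> (e \<otimes> v) \<oplus> (\<one> \<ominus> e) \<otimes> (\<one> \<ominus> e)"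
    unfolding central[symmetric] using c by (simp add: l_distr r_distr a_ac)
  also have "(e \<otimes> u) \<otimes> (e \<otimes> v) = e \<otimes> (u \<otimes> v)"
    using c idem central by (metis m_assoc m_closed)
  also have "(u \<otimes> e) \<otimes> (\<one> \<ominus> e) = \<zero>"
    using c ann by (simp add: m_assoc)
  also have "(\<one> \<ominus> e) \<otimes> (e \<otimes> v) = \<zero>"
    using c ann by (simp flip: m_assoc)
  finally show ?thesis
    unfolding inv ee using c by simp algebra
qed

text \<open>
  The inverse is \<open>e s\<^sup>2 + (1 - e)\<close> for \<open>e = a s\<close>: on the corner of e the elements a and s are inverse
  to each other.
\<close>

lemma (in ring) square_on_reduced_corner_Units:
  assumes red: "reduced_ideal K R" and as: "a \<in> carrier R" "s \<in> carrier R"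
    and e: "a \<otimes> s \<in> K" "(a \<otimes> s) \<otimes> (a \<otimes> s) = a \<otimes> s"
  shows "(a \<otimes> s) \<otimes> (a \<otimes> a) \<oplus> (\<one> \<ominus> a \<otimes> s) \<in> Units R"
proof -
  define e where "e = a \<otimes> s"
  have c: "e \<in> carrier R" using as by (simp add: e_def)
  have idem: "e \<otimes> e = e" using assms by (simp add: e_def)
  have central: "e \<otimes> r = r \<otimes> e" if "r \<in> carrier R" for r
    unfolding e_def using idempotent_central_if_reduced_ideal[OF red e that] .
  have sa: "e \<otimes> (s \<otimes> a) = e"
    unfolding e_def by (rule right_inverse_in_reduced_corner[OF assms])
  have left: "e \<otimes> ((s \<otimes> s) \<otimes> (a \<otimes> a)) = e"
  proof -
    have "e \<otimes> ((s \<otimes> s) \<otimes> (a \<otimes> a)) = e \<otimes> s \<otimes> (s \<otimes> a) \<otimes> a"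
      using as c by (simp add: m_assoc)
    also have "\<dots> = s \<otimes> (e \<otimes> (s \<otimes> a)) \<otimes> a"
      using as c central[of s] by (simp add: m_assoc)
    also have "\<dots> = e \<otimes> (s \<otimes> a)"
      using sa as c central[of s] by (simp flip: m_assoc)
    finally show ?thesis using sa by simp
  qed
  have right: "e \<otimes> ((a \<otimes> a) \<otimes> (s \<otimes> s)) = e"
  proof -
    have "e \<otimes> ((a \<otimes> a) \<otimes> (s \<otimes> s)) = e \<otimes> (a \<otimes> e) \<otimes> s"
      using as c by (simp add: m_assoc e_def)
    also have "\<dots> = e \<otimes> e \<otimes> e"
      unfolding central[OF as(1), symmetric] using as c by (simp add: m_assoc e_def)
    finally show ?thesis using idem by simp
  qed
  have "e \<otimes> (a \<otimes> a) \<oplus> (\<one> \<ominus> e) \<in> Units R"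
  proof (rule Units_if_one_sided_inverses)
    show "(e \<otimes> (s \<otimes> s) \<oplus> (\<one> \<ominus> e)) \<otimes> (e \<otimes> (a \<otimes> a) \<oplus> (\<one> \<ominus> e)) = \<one>"
      by (rule central_idempotent_glue_inverse[OF c _ _ idem central left]) (use as in auto)
    show "(e \<otimes> (a \<otimes> a) \<oplus> (\<one> \<ominus> e)) \<otimes> (e \<otimes> (s \<otimes> s) \<oplus> (\<one> \<ominus> e)) = \<one>"
      by (rule central_idempotent_glue_inverse[OF c _ _ idem central right]) (use as in auto)
  qed (use as c in auto)
  then show ?thesis by (simp add: e_def)
qed

section \<open>Square stability\<close>

text \<open>
  Square stability is applied to a and \<open>b = 1 - a r\<close>, which are right comaximal for every r; removing
  the radical summand \<open>a\<^sup>2\<close> from the resulting unit leaves the unit \<open>b y\<close>.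
\<close>

lemma (in ring) square_stable_imp_radical_square_closed:
  assumes "ideal I R" "square_stable I R" "a \<in> I" "a \<otimes> a \<in> jacobson_radical R"
  shows "a \<in> jacobson_radical R"
  unfolding jacobson_radical_iff
proof (intro conjI ballI)
  show ac: "a \<in> carrier R"
    using assms(1,3) by (simp add: ideal.Icarr)
  fix r assume r: "r \<in> carrier R"
  let ?b = "\<one> \<ominus> a \<otimes> r"
  have b: "?b \<in> carrier R" using ac r by simp
  have "(a <# carrier R) <+>\<^bsub>R\<^esub> (?b <# carrier R) = carrier R"
  proof
    show "(a <# carrier R) <+>\<^bsub>R\<^esub> (?b <# carrier R) \<subseteq> carrier R"
      using ac b by (auto simp: set_add_def' l_coset_def)
    show "carrier R \<subseteq> (a <# carrier R) <+>\<^bsub>R\<^esub> (?b <# carrier R)"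
    proof
      fix x assume x: "x \<in> carrier R"
      then have "x = a \<otimes> (r \<otimes> x) \<oplus> ?b \<otimes> x"
        using ac r by (simp add: ring_simprules)
      then show "x \<in> (a <# carrier R) <+>\<^bsub>R\<^esub> (?b <# carrier R)"
        using x r unfolding set_add_def' l_coset_def by blast
    qed
  qed
  then obtain y where y: "y \<in> carrier R" "a [^] (2::nat) \<oplus> ?b \<otimes> y \<in> Units R"
    using assms(2,3) b unfolding square_stable_def by blast
  have "(a \<otimes> a \<oplus> ?b \<otimes> y) \<ominus> a \<otimes> a \<in> Units R"
    using Units_minus_jacobson_radical y(2) assms(4) ac by (simp add: numeral_2_eq_2)
  also have "(a \<otimes> a \<oplus> ?b \<otimes> y) \<ominus> a \<otimes> a = ?b \<otimes> y"
    using ac r y(1) by algebra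
  finally have by_unit: "?b \<otimes> y \<in> Units R" .
  then have "?b \<otimes> (y \<otimes> inv (?b \<otimes> y)) = \<one>"
    using b y(1) by (simp flip: m_assoc)
  then show "\<exists>u\<in>carrier R. ?b \<otimes> u = \<one>"
    using y(1) by_unit by blast
qed

lemma (in ring) reduced_ideal_mod_jacobson_radical:
  assumes I: "ideal I R"
    and closed: "\<And>a. a \<in> I \<Longrightarrow> a \<otimes> a \<in> jacobson_radical R \<Longrightarrow> a \<in> jacobson_radical R"
  shows "reduced_ideal ((+>) (jacobson_radical R) ` I) (R Quot jacobson_radical R)"
proof -
  let ?J = "jacobson_radical R"
  interpret J: ideal ?J R by (rule ideal_jacobson_radical)
  interpret h: ring_hom_ring R "R Quot ?J" "(+>) ?J" by (rule J.rcos_ring_hom_ring)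
  have "?J +> a = \<zero>\<^bsub>R Quot ?J\<^esub>"
    if a: "a \<in> I" and sq: "(?J +> a) \<otimes>\<^bsub>R Quot ?J\<^esub> (?J +> a) = \<zero>\<^bsub>R Quot ?J\<^esub>" for a
  proof -
    have ac: "a \<in> carrier R" using I a by (simp add: ideal.Icarr)
    then have "a \<otimes> a \<in> ?J"
      using sq by (simp flip: quotient_class_eq_zero_iff[OF J.ideal_axioms])
    then show ?thesis
      using closed a ac by (simp add: quotient_class_eq_zero_iff[OF J.ideal_axioms])
  qed
  then show ?thesis
    using ring_ideal_imp_quot_ideal[OF J.ideal_axioms I] by (auto simp: reduced_ideal_def)
qed

text \<open>
  From \<open>1 = a x + b y\<close> and \<open>e = a x + q - a x q\<close> one gets
  \<open>1 - e = (1 - a x) (1 - q) = b y (1 - q)\<close>.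
\<close>

lemma (in ring) exchange_ideal_split:
  assumes ex: "exchange_ideal I R" and a: "a \<in> I" and b: "b \<in> carrier R"
    and gen: "(a <# carrier R) <+>\<^bsub>R\<^esub> (b <# carrier R) = carrier R"
  obtains s t where "s \<in> carrier R" "t \<in> carrier R"
    "a \<otimes> s \<in> I" "(a \<otimes> s) \<otimes> (a \<otimes> s) = a \<otimes> s" "\<one> \<ominus> a \<otimes> s = b \<otimes> t"
proof -
  interpret ideal I R using ex by (simp add: exchange_ideal_def)
  have ac: "a \<in> carrier R" using a by (rule Icarr)
  obtain x y where xy: "x \<in> carrier R" "y \<in> carrier R" "\<one> = a \<otimes> x \<oplus> b \<otimes> y"
    using gen one_closed unfolding set_add_def' l_coset_def by blast
  have "a \<otimes> x \<in> I" using a xy by (simp add: I_r_closed)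
  then obtain e p q where e: "e \<in> I" "p \<in> I" "q \<in> I" "e \<otimes> e = e"
      "e = a \<otimes> x \<otimes> p" "e = a \<otimes> x \<oplus> q \<ominus> a \<otimes> x \<otimes> q"
    using ex unfolding exchange_ideal_def by blast
  have pq: "p \<in> carrier R" "q \<in> carrier R" using e Icarr by auto
  have eas: "e = a \<otimes> (x \<otimes> p)" using e(5) ac xy pq by (simp add: m_assoc)
  have "\<one> \<ominus> e = (\<one> \<ominus> a \<otimes> x) \<otimes> (\<one> \<ominus> q)"
    unfolding e(6) using ac xy(1) pq by (simp add: ring_simprules)
  also have "\<one> \<ominus> a \<otimes> x = (a \<otimes> x \<oplus> b \<otimes> y) \<ominus> a \<otimes> x" using xy(3) by simp
  also have "\<dots> = b \<otimes> y" using ac b xy(1,2) by algebra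
  also have "b \<otimes> y \<otimes> (\<one> \<ominus> q) = b \<otimes> (y \<otimes> (\<one> \<ominus> q))"
    using b xy(1,2) pq by (simp add: m_assoc)
  finally show ?thesis
    using that[of "x \<otimes> p" "y \<otimes> (\<one> \<ominus> q)"] e(1,4) xy(1,2) pq unfolding eas by simp
qed

text \<open>
  The exchange idempotent is taken in R, so no idempotent needs to be lifted; the quotient by the
  radical serves only to make that idempotent central.
\<close>

lemma (in ring) radical_square_closed_imp_square_stable:
  assumes ex: "exchange_ideal I R"
    and closed: "\<And>a. a \<in> I \<Longrightarrow> a \<otimes> a \<in> jacobson_radical R \<Longrightarrow> a \<in> jacobson_radical R"
  shows "square_stable I R"
  unfolding square_stable_def
proof (intro ballI impI)
  fix a b assume a: "a \<in> I" and b: "b \<in> carrier R"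
    and gen: "(a <# carrier R) <+>\<^bsub>R\<^esub> (b <# carrier R) = carrier R"
  have I: "ideal I R" using ex by (simp add: exchange_ideal_def)
  have ac: "a \<in> carrier R" using I a by (simp add: ideal.Icarr)
  obtain s t where st: "s \<in> carrier R" "t \<in> carrier R"
      and e: "a \<otimes> s \<in> I" "(a \<otimes> s) \<otimes> (a \<otimes> s) = a \<otimes> s" "\<one> \<ominus> a \<otimes> s = b \<otimes> t"
    using exchange_ideal_split[OF ex a b gen] by blast
  let ?J = "jacobson_radical R"
  let ?z = "(a \<otimes> s) \<otimes> (a \<otimes> a) \<oplus> (\<one> \<ominus> a \<otimes> s)"
  interpret J: ideal ?J R by (rule ideal_jacobson_radical)
  interpret h: ring_hom_ring R "R Quot ?J" "(+>) ?J" by (rule J.rcos_ring_hom_ring)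
  have "?J +> ?z \<in> Units (R Quot ?J)"
  proof -
    let ?a = "?J +> a" and ?s = "?J +> s"
    have "?a \<otimes>\<^bsub>R Quot ?J\<^esub> ?s = ?J +> (a \<otimes> s)" using ac st by simp
    moreover have "\<dots> \<in> (+>) ?J ` I" using e(1) by blast
    moreover have "(?J +> (a \<otimes> s)) \<otimes>\<^bsub>R Quot ?J\<^esub> (?J +> (a \<otimes> s)) = ?J +> (a \<otimes> s)"
      using e(2) ac st by (metis h.hom_mult m_closed)
    ultimately have "(?a \<otimes>\<^bsub>R Quot ?J\<^esub> ?s) \<otimes>\<^bsub>R Quot ?J\<^esub> (?a \<otimes>\<^bsub>R Quot ?J\<^esub> ?a)
        \<oplus>\<^bsub>R Quot ?J\<^esub> (\<one>\<^bsub>R Quot ?J\<^esub> \<ominus>\<^bsub>R Quot ?J\<^esub> ?a \<otimes>\<^bsub>R Quot ?J\<^esub> ?s) \<in> Units (R Quot ?J)"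
      using reduced_ideal_mod_jacobson_radical[OF I closed] ac st
      by (intro h.S.square_on_reduced_corner_Units) auto
    then show ?thesis using ac st by (simp add: minus_eq h.S.minus_eq)
  qed
  then have "?z \<in> Units R"
    using ac st by (intro Units_lift_jacobson_radical) auto
  also have "?z = a \<otimes> a \<oplus> (\<one> \<ominus> a \<otimes> s) \<otimes> (\<one> \<ominus> a \<otimes> a)"
    using ac st by (simp add: ring_simprules)
  also have "\<dots> = a [^] (2::nat) \<oplus> b \<otimes> (t \<otimes> (\<one> \<ominus> a \<otimes> a))"
    unfolding e(3) using ac b st by (simp add: m_assoc numeral_2_eq_2)
  finally show "\<exists>y\<in>carrier R. a [^] (2::nat) \<oplus> b \<otimes> y \<in> Units R"
    using ac st by blast
qed

theorem theorem2p5: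
  fixes R :: "('a, 'm) ring_scheme" and I :: "'a set"
  assumes "ring R" and "exchange_ideal I R"
  shows "square_stable I R \<longleftrightarrow>
    (\<forall>a\<in>I. a [^]\<^bsub>R\<^esub> (2::nat) \<in> jacobson_radical R \<longrightarrow> a \<in> jacobson_radical R)"
proof -
  interpret ring R by fact
  have I: "ideal I R" using assms(2) by (simp add: exchange_ideal_def)
  have "a [^]\<^bsub>R\<^esub> (2::nat) = a \<otimes>\<^bsub>R\<^esub> a" if "a \<in> I" for a
    using I that by (simp add: ideal.Icarr numeral_2_eq_2)
  then show ?thesis
    using square_stable_imp_radical_square_closed[OF I]
      radical_square_closed_imp_square_stable[OF assms(2)] by auto
qed

end
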